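(* Let $f:[0,\infty)\to\mathbb R$, and for $0\le\lambda\le1$ let \[ J_{f,\lambda}(s,d)=\lambda f(s+d)+(1-\lambda)f(s)-f(s+\lambda d),\qquad s,d\ge0. \] Then the following assertions hold. 1. The entrywise map induced by $f$ is Loewner convex on $\mathcal C_{\min,n}$ for every $n\ge1$ if and only if, for every $0\le\lambda\le1$, the function $(s,d)\mapsto J_{f,\lambda}(s,d)$ on $[0,\infty)^2$ is nondecreasing in each variable separately. 2. The entrywise map induced by $f$ is Loewner concave on $\mathcal C_{\min,n}$ for every $n\ge1$ if and only if, for every $0\le\lambda\le1$, the function $(s,d)\mapsto J_{f,\lambda}(s,d)$ on $[0,\infty)^2$ is nonincreasing in each variable separately. The same characterizations hold with $\mathcal C_{\min,n}$ replaced by $\mathcal C_{\max,n}$. In each assertion, for the necessity of the condition on $J_{f,\lambda}$ it is sufficient to assume the Loewner convexity (respectively concavity) only in dimension $n=2$.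
   Context: For $x=(x_1,\ldots,x_n)\in\mathbb R^n$, define the $n\times n$ real symmetric matrices $A_{\min}(x)=\bigl(x_{\min(i,j)}\bigr)_{i,j=1}^n$ and $A_{\max}(x)=\bigl(x_{\max(i,j)}\bigr)_{i,j=1}^n$. Set $\mathcal C_{\min,n}=\{A_{\min}(x):0\le x_1\le x_2\le\cdots\le x_n\}$ and $\mathcal C_{\max,n}=\{A_{\max}(x):x_1\ge x_2\ge\cdots\ge x_n\ge0\}$; both are convex cones. For a matrix $A=(a_{ij})$ with entries in $[0,\infty)$, $f[A]=(f(a_{ij}))$; the entrywise map induced by $f$ is $A\mapsto f[A]$. For real symmetric matrices, $A\preceq B$ means that $B-A$ is positive semidefinite. Comparable-pairs convention: the entrywise map induced by $f$ is called Loewner convex on $\mathcal C$ (where $\mathcal C=\mathcal C_{\min,n}$ or $\mathcal C_{\max,n}$) if $f[\lambda A+(1-\lambda)B]\preceq\lambda f[A]+(1-\lambda)f[B]$ whenever $A,B\in\mathcal C$, $B\preceq A$ and $0\le\lambda\le1$. It is called Loewner concave on $\mathcal C$ if the reverse inequality $\lambda f[A]+(1-\lambda)f[B]\preceq f[\lambda A+(1-\lambda)B]$ holds for all such $A,B,\lambda$. *)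

theory Defs
  imports "Jordan_Normal_Form.Matrix"
begin

text \<open>
  Matrices and vectors are those of \<open>Jordan_Normal_Form\<close>, since the dimension is quantified
  inside the statement. Their indices start at \<open>0\<close>, so the entry \<open>x\<^sub>i\<close> of the
  mathematical text is \<open>x $ (i - 1)\<close> here.

  A function from \<open>[0, \<infinity>)\<close> to the reals is a total \<open>f :: real \<Rightarrow> real\<close>
  of which only the values at nonnegative arguments are used.
\<close>

definition A_min :: "real vec \<Rightarrow> real mat" where
  "A_min x = mat (dim_vec x) (dim_vec x) (\<lambda>(i, j). x $ min i j)"

definition A_max :: "real vec \<Rightarrow> real mat" where
  "A_max x = mat (dim_vec x) (dim_vec x) (\<lambda>(i, j). x $ max i j)"

definition C_min :: "nat \<Rightarrow> real mat set" where
  "C_min n = {A_min x | x. x \<in> carrier_vec n \<and> (\<forall>i<n. 0 \<le> x $ i) \<and>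
                (\<forall>i j. i \<le> j \<and> j < n \<longrightarrow> x $ i \<le> x $ j)}"

definition C_max :: "nat \<Rightarrow> real mat set" where
  "C_max n = {A_max x | x. x \<in> carrier_vec n \<and> (\<forall>i<n. 0 \<le> x $ i) \<and>
                (\<forall>i j. i \<le> j \<and> j < n \<longrightarrow> x $ j \<le> x $ i)}"

definition psd :: "nat \<Rightarrow> real mat \<Rightarrow> bool" where
  "psd n A \<longleftrightarrow> A \<in> carrier_mat n n \<and> A\<^sup>T = A \<and>
     (\<forall>v \<in> carrier_vec n. 0 \<le> v \<bullet> (A *\<^sub>v v))"

definition loewner_le :: "nat \<Rightarrow> real mat \<Rightarrow> real mat \<Rightarrow> bool" where
  "loewner_le n A B \<longleftrightarrow> psd n (B - A)"

text \<open>
  Convexity and concavity are required only along comparable pairs. The entrywise map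
  \<open>f[A]\<close> is \<open>map_mat f A\<close>.
\<close>

definition loewner_convex_on :: "nat \<Rightarrow> real mat set \<Rightarrow> (real \<Rightarrow> real) \<Rightarrow> bool" where
  "loewner_convex_on n C f \<longleftrightarrow>
     (\<forall>A\<in>C. \<forall>B\<in>C. \<forall>l. loewner_le n B A \<and> 0 \<le> l \<and> l \<le> 1 \<longrightarrow>
        loewner_le n (map_mat f (l \<cdot>\<^sub>m A + (1 - l) \<cdot>\<^sub>m B))
                     (l \<cdot>\<^sub>m map_mat f A + (1 - l) \<cdot>\<^sub>m map_mat f B))"

definition loewner_concave_on :: "nat \<Rightarrow> real mat set \<Rightarrow> (real \<Rightarrow> real) \<Rightarrow> bool" where
  "loewner_concave_on n C f \<longleftrightarrow>
     (\<forall>A\<in>C. \<forall>B\<in>C. \<forall>l. loewner_le n B A \<and> 0 \<le> l \<and> l \<le> 1 \<longrightarrow>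
        loewner_le n (l \<cdot>\<^sub>m map_mat f A + (1 - l) \<cdot>\<^sub>m map_mat f B)
                     (map_mat f (l \<cdot>\<^sub>m A + (1 - l) \<cdot>\<^sub>m B)))"

definition J :: "(real \<Rightarrow> real) \<Rightarrow> real \<Rightarrow> real \<Rightarrow> real \<Rightarrow> real" where
  "J f l s d = l * f (s + d) + (1 - l) * f s - f (s + l * d)"

definition nondecreasing_separately :: "(real \<Rightarrow> real \<Rightarrow> real) \<Rightarrow> bool" where
  "nondecreasing_separately g \<longleftrightarrow>
     (\<forall>d\<ge>0. mono_on {0..} (\<lambda>s. g s d)) \<and> (\<forall>s\<ge>0. mono_on {0..} (\<lambda>d. g s d))"

definition nonincreasing_separately :: "(real \<Rightarrow> real \<Rightarrow> real) \<Rightarrow> bool" where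
  "nonincreasing_separately g \<longleftrightarrow>
     (\<forall>d\<ge>0. antimono_on {0..} (\<lambda>s. g s d)) \<and> (\<forall>s\<ge>0. antimono_on {0..} (\<lambda>d. g s d))"

end

theory Submission
  imports Defs
begin

text \<open>
  Every operation in sight acts on \<open>A_min x\<close> through the vector \<open>x\<close> alone:
  linear combinations and entrywise maps of matrices \<open>A_min x\<close> are again of this form.
  Two observations then settle the matter.

  First, \<open>A_min x\<close> is positive semidefinite exactly if \<open>x\<close> is nonnegative and
  nondecreasing (\<open>psd_A_min_iff\<close>): writing \<open>x\<^sub>i\<close> as the sum of its
  increments turns the quadratic form into a sum of squares weighted by these increments, and
  conversely the increments are values of the form.

  Second, if \<open>A = A_min x\<close> and \<open>B = A_min y\<close>, then the gap
  \<open>l f[A] + (1 - l) f[B] - f[l A + (1 - l) B]\<close> is \<open>A_min z\<close> with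
  \<open>z\<^sub>i = J f l y\<^sub>i (x\<^sub>i - y\<^sub>i)\<close> (\<open>jensen_gap_A_min\<close>).
  By the first observation \<open>B \<preceq> A\<close> makes \<open>d = x - y\<close>, like \<open>y\<close>,
  nonnegative and nondecreasing, and convexity requires the same of \<open>J f l y\<^sub>i d\<^sub>i\<close>.
  If \<open>J f l\<close> is monotone in each variable, this holds in every dimension;
  nonnegativity comes from \<open>J f l s 0 = 0\<close>. Conversely, vectors \<open>y\<close> and
  \<open>d\<close> with two entries already compare the values of \<open>J f l\<close> at any two
  points that are ordered in both coordinates.

  The remaining cases follow by symmetry: reversing the order of the indices exchanges the
  cones \<open>C_min n\<close> and \<open>C_max n\<close> and preserves the Loewner order, while
  passing from \<open>f\<close> to \<open>- f\<close> exchanges convexity and concavity.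
\<close>

section \<open>Positive semidefinite matrices of the form \<open>A_min x\<close>\<close>

definition ramp :: "nat \<Rightarrow> real vec \<Rightarrow> bool" where
  "ramp n x \<longleftrightarrow> (\<forall>i<n. 0 \<le> x $ i) \<and> (\<forall>i j. i \<le> j \<and> j < n \<longrightarrow> x $ i \<le> x $ j)"

lemma C_min_eq_ramp: "C_min n = {A_min x | x. x \<in> carrier_vec n \<and> ramp n x}"
  unfolding C_min_def ramp_def by simp

lemma quadratic_form_eq_sum:
  fixes A :: "real mat"
  assumes "A \<in> carrier_mat n n" "v \<in> carrier_vec n"
  shows "v \<bullet> (A *\<^sub>v v) = (\<Sum>i<n. \<Sum>j<n. v $ i * v $ j * A $$ (i, j))"
  using assms
  by (auto simp: scalar_prod_def mult_mat_vec_def sum_distrib_left lessThan_atLeast0 mult_ac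
      intro!: sum.cong)

text \<open>
  The matrix with entries \<open>x\<^sub>m\<^sub>i\<^sub>n\<^sub>(\<^sub>i\<^sub>,\<^sub>j\<^sub>)\<close> is the sum over \<open>k\<close> of
  the \<open>k\<close>-th increment of \<open>x\<close> times the rank-one indicator of
  \<open>k \<le> i \<and> k \<le> j\<close>; each of these indicators contributes a square to the form.
\<close>
lemma min_form_eq_sum_squares:
  fixes x v :: "nat \<Rightarrow> real"
  shows "(\<Sum>i<n. \<Sum>j<n. v i * v j * x (min i j)) =
    (\<Sum>k<n. (x k - (if k = 0 then 0 else x (k - 1))) * (\<Sum>i<n. if k \<le> i then v i else 0)\<^sup>2)"
proof -
  define \<delta> where "\<delta> k = x k - (if k = 0 then 0 else x (k - 1))" for k
  have telescope: "x m = (\<Sum>k\<le>m. \<delta> k)" for m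
    by (induction m) (simp_all add: \<delta>_def)
  have layers: "x (min i j) = (\<Sum>k<n. \<delta> k * (if k \<le> i then 1 else 0) * (if k \<le> j then 1 else 0))"
    if "i < n" "j < n" for i j
  proof -
    have "(\<Sum>k<n. \<delta> k * (if k \<le> i then 1 else 0) * (if k \<le> j then 1 else 0)) = (\<Sum>k\<le>min i j. \<delta> k)"
      using that by (intro sum.mono_neutral_cong_right) auto
    then show ?thesis using telescope by simp
  qed
  have "(\<Sum>i<n. \<Sum>j<n. v i * v j * x (min i j)) =
     (\<Sum>i<n. \<Sum>j<n. \<Sum>k<n. \<delta> k * ((if k \<le> i then v i else 0) * (if k \<le> j then v j else 0)))"
    by (auto simp: layers sum_distrib_left intro!: sum.cong)
  also have "\<dots> = (\<Sum>i<n. \<Sum>k<n. \<Sum>j<n. \<delta> k * ((if k \<le> i then v i else 0) * (if k \<le> j then v j else 0)))"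
    by (intro sum.cong sum.swap refl)
  also have "\<dots> = (\<Sum>k<n. \<Sum>i<n. \<Sum>j<n. \<delta> k * ((if k \<le> i then v i else 0) * (if k \<le> j then v j else 0)))"
    by (rule sum.swap)
  also have "\<dots> = (\<Sum>k<n. \<delta> k * (\<Sum>i<n. if k \<le> i then v i else 0)\<^sup>2)"
    unfolding power2_eq_square sum_product by (simp only: sum_distrib_left)
  finally show ?thesis unfolding \<delta>_def .
qed

lemma A_min_carrier: "x \<in> carrier_vec n \<Longrightarrow> A_min x \<in> carrier_mat n n"
  by (auto simp: A_min_def)

text \<open>
  The increments of \<open>x\<close>, with \<open>x\<^sub>0\<close> itself as the first one, are the weights
  in the sum of squares, so their nonnegativity suffices. It is necessary because the form takes
  the value \<open>x\<^sub>k\<close> at the unit vector \<open>e\<^sub>k\<close> and the value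
  \<open>x\<^sub>b - x\<^sub>a\<close> at \<open>e\<^sub>b - e\<^sub>a\<close> for \<open>a < b\<close>.
\<close>
lemma psd_A_min_iff:
  assumes x: "x \<in> carrier_vec n"
  shows "psd n (A_min x) \<longleftrightarrow> ramp n x"
proof
  assume psd: "psd n (A_min x)"
  have form: "0 \<le> (\<Sum>i<n. \<Sum>j<n. w i * w j * x $ min i j)" for w
  proof -
    have "0 \<le> vec n w \<bullet> (A_min x *\<^sub>v vec n w)"
      using psd unfolding psd_def by auto
    also have "\<dots> = (\<Sum>i<n. \<Sum>j<n. w i * w j * x $ min i j)"
      using x by (subst quadratic_form_eq_sum[OF A_min_carrier[OF x]])
        (auto simp: A_min_def intro!: sum.cong)
    finally show ?thesis .
  qed
  have nonneg: "0 \<le> x $ k" if "k < n" for k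
  proof -
    have "(\<Sum>i<n. \<Sum>j<n. of_bool (i = k) * of_bool (j = k) * x $ min i j) = x $ k"
      using that by (simp add: mult.assoc flip: sum_distrib_left)
    then show ?thesis using form[of "\<lambda>i. of_bool (i = k)"] by simp
  qed
  have mono: "x $ a \<le> x $ b" if "a < b" "b < n" for a b
  proof -
    \<comment> \<open>The form at \<open>e\<^sub>b - e\<^sub>a\<close> is \<open>x\<^sub>b - 2 x\<^sub>a + x\<^sub>a\<close>.\<close>
    define w :: "nat \<Rightarrow> real" where "w i = of_bool (i = b) - of_bool (i = a)" for i
    have row: "(\<Sum>j<n. w j * x $ min i j) = x $ min i b - x $ min i a" for i
      using that by (simp add: w_def left_diff_distrib sum_subtractf)
    have "(\<Sum>i<n. \<Sum>j<n. w i * w j * x $ min i j) = (\<Sum>i<n. w i * (x $ min i b - x $ min i a))"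
      by (simp add: row mult.assoc flip: sum_distrib_left)
    also have "\<dots> = (x $ min b b - x $ min b a) - (x $ min a b - x $ min a a)"
      using that by (simp add: w_def left_diff_distrib sum_subtractf)
    also have "\<dots> = x $ b - x $ a" using that by simp
    finally show ?thesis using form[of w] by simp
  qed
  show "ramp n x"
    unfolding ramp_def using nonneg mono by (metis le_neq_implies_less order_refl)
next
  assume ramp: "ramp n x"
  have "0 \<le> v \<bullet> (A_min x *\<^sub>v v)" if v: "v \<in> carrier_vec n" for v
  proof -
    have "v \<bullet> (A_min x *\<^sub>v v) = (\<Sum>i<n. \<Sum>j<n. v $ i * v $ j * x $ min i j)"
      using x by (subst quadratic_form_eq_sum[OF A_min_carrier[OF x] v])
        (auto simp: A_min_def intro!: sum.cong)
    also have "\<dots> \<ge> 0"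
      unfolding min_form_eq_sum_squares[where x = "\<lambda>i. x $ i"]
      using ramp by (intro sum_nonneg mult_nonneg_nonneg) (auto simp: ramp_def)
    finally show ?thesis .
  qed
  moreover have "(A_min x)\<^sup>T = A_min x"
    by (rule eq_matI) (auto simp: A_min_def min.commute)
  ultimately show "psd n (A_min x)"
    unfolding psd_def using A_min_carrier[OF x] by simp
qed

section \<open>Convexity on \<open>C_min n\<close>\<close>

lemma A_min_diff:
  assumes "x \<in> carrier_vec n" "y \<in> carrier_vec n"
  shows "A_min x - A_min y = A_min (x - y)"
  using assms by (intro eq_matI) (auto simp: A_min_def)

lemma loewner_le_A_min_iff:
  assumes "x \<in> carrier_vec n" "y \<in> carrier_vec n"
  shows "loewner_le n (A_min y) (A_min x) \<longleftrightarrow> ramp n (x - y)"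
  unfolding loewner_le_def A_min_diff[OF assms] using assms by (intro psd_A_min_iff) auto

lemma jensen_gap_A_min:
  assumes "x \<in> carrier_vec n" "y \<in> carrier_vec n"
  shows "l \<cdot>\<^sub>m map_mat f (A_min x) + (1 - l) \<cdot>\<^sub>m map_mat f (A_min y)
      - map_mat f (l \<cdot>\<^sub>m A_min x + (1 - l) \<cdot>\<^sub>m A_min y)
    = A_min (vec n (\<lambda>i. J f l (y $ i) (x $ i - y $ i)))"
  using assms by (intro eq_matI) (auto simp: A_min_def J_def algebra_simps)

text \<open>
  The comparable pairs in the cone are exactly the pairs \<open>A_min (y + d)\<close>, \<open>A_min y\<close>
  with ramps \<open>y\<close> and \<open>d\<close>, since a sum of ramps is a ramp. In these coordinates the
  Loewner order disappears from the definition of convexity.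
\<close>
lemma convex_on_C_min_iff:
  "loewner_convex_on n (C_min n) f \<longleftrightarrow>
    (\<forall>y d l. y \<in> carrier_vec n \<and> d \<in> carrier_vec n \<and> ramp n y \<and> ramp n d \<and> 0 \<le> l \<and> l \<le> 1 \<longrightarrow>
      ramp n (vec n (\<lambda>i. J f l (y $ i) (d $ i))))"
    (is "?L \<longleftrightarrow> ?R")
proof
  assume L: ?L
  show ?R
  proof (intro allI impI, elim conjE)
    fix y d l
    assume y: "y \<in> carrier_vec n" "ramp n y" and d: "d \<in> carrier_vec n" "ramp n d"
      and l: "0 \<le> l" "l \<le> (1 :: real)"
    define x where "x = y + d"
    have x: "x \<in> carrier_vec n" "ramp n x"
      using y d by (auto simp: x_def ramp_def intro!: add_mono)
    have diff: "x - y = d"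
      using y d by (auto simp: x_def)
    have "psd n (A_min (vec n (\<lambda>i. J f l (y $ i) (x $ i - y $ i))))"
      using L x y d l loewner_le_A_min_iff[OF x(1) y(1)]
      unfolding loewner_convex_on_def C_min_eq_ramp diff
      by (subst jensen_gap_A_min[OF x(1) y(1), symmetric]) (auto simp: loewner_le_def)
    moreover have "vec n (\<lambda>i. J f l (y $ i) (x $ i - y $ i)) = vec n (\<lambda>i. J f l (y $ i) (d $ i))"
      using y d by (auto simp: x_def)
    ultimately show "ramp n (vec n (\<lambda>i. J f l (y $ i) (d $ i)))"
      by (simp add: psd_A_min_iff)
  qed
next
  assume R: ?R
  show ?L
    unfolding loewner_convex_on_def
  proof (intro ballI allI impI, elim conjE)
    fix A B l
    assume "A \<in> C_min n" "B \<in> C_min n" and le: "loewner_le n B A" and l: "0 \<le> l" "l \<le> (1 :: real)"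
    then obtain x y where x: "A = A_min x" "x \<in> carrier_vec n"
      and y: "B = A_min y" "y \<in> carrier_vec n" "ramp n y"
      unfolding C_min_eq_ramp by auto
    have "ramp n (x - y)"
      using le loewner_le_A_min_iff[OF x(2) y(2)] x y by simp
    then have "ramp n (vec n (\<lambda>i. J f l (y $ i) ((x - y) $ i)))"
      using R x y l by (meson minus_carrier_vec)
    moreover have "vec n (\<lambda>i. J f l (y $ i) ((x - y) $ i)) = vec n (\<lambda>i. J f l (y $ i) (x $ i - y $ i))"
      using x y by auto
    ultimately show "loewner_le n (map_mat f (l \<cdot>\<^sub>m A + (1 - l) \<cdot>\<^sub>m B))
        (l \<cdot>\<^sub>m map_mat f A + (1 - l) \<cdot>\<^sub>m map_mat f B)"
      unfolding loewner_le_def x(1) y(1) jensen_gap_A_min[OF x(2) y(2)]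
      by (simp add: psd_A_min_iff)
  qed
qed

lemma nondecreasing_separately_imp_le:
  assumes "nondecreasing_separately g" "0 \<le> s" "s \<le> t" "0 \<le> d" "d \<le> e"
  shows "g s d \<le> g t e"
proof -
  have "g s d \<le> g t d"
    using assms unfolding nondecreasing_separately_def by (auto simp: mono_on_def)
  also have "\<dots> \<le> g t e"
    using assms unfolding nondecreasing_separately_def by (auto simp: mono_on_def)
  finally show ?thesis .
qed

text \<open>
  Monotonicity of \<open>J f l\<close> orders the entries of the gap vector; they are nonnegative because
  \<open>J f l s e\<close> is at least \<open>J f l s 0 = 0\<close>.
\<close>
lemma convex_on_C_min_if_nondecreasing:
  assumes mono: "\<And>l. 0 \<le> l \<Longrightarrow> l \<le> 1 \<Longrightarrow> nondecreasing_separately (J f l)"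
  shows "loewner_convex_on n (C_min n) f"
  unfolding convex_on_C_min_iff
proof (intro allI impI, elim conjE)
  fix y d :: "real vec" and l :: real
  assume y: "ramp n y" and d: "ramp n d" and l: "0 \<le> l" "l \<le> 1"
  have "0 \<le> J f l s e" if "0 \<le> s" "0 \<le> e" for s e
  proof -
    have "J f l s 0 \<le> J f l s e"
      using nondecreasing_separately_imp_le[OF mono[OF l]] that by blast
    then show ?thesis by (simp add: J_def algebra_simps)
  qed
  then show "ramp n (vec n (\<lambda>i. J f l (y $ i) (d $ i)))"
    using y d nondecreasing_separately_imp_le[OF mono[OF l]] by (auto simp: ramp_def)
qed

text \<open>
  Two ordered points \<open>(s, d)\<close> and \<open>(t, e)\<close> are the two index positions of the ramps
  \<open>(s, t)\<close> and \<open>(d, e)\<close>, so that the gap vector compares \<open>J f l\<close> at these points.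
\<close>
lemma nondecreasing_if_convex_on_C_min_2:
  assumes conv: "loewner_convex_on 2 (C_min 2) f" and l: "0 \<le> l" "l \<le> 1"
  shows "nondecreasing_separately (J f l)"
proof -
  have le: "J f l s d \<le> J f l t e" if "0 \<le> s" "s \<le> t" "0 \<le> d" "d \<le> e" for s t d e
  proof -
    define y where "y = vec 2 (\<lambda>i. if i = 0 then s else t)"
    define c where "c = vec 2 (\<lambda>i. if i = 0 then d else e)"
    have "ramp 2 y" "ramp 2 c" "y \<in> carrier_vec 2" "c \<in> carrier_vec 2"
      using that by (auto simp: ramp_def y_def c_def)
    then have "ramp 2 (vec 2 (\<lambda>i. J f l (y $ i) (c $ i)))"
      using conv l unfolding convex_on_C_min_iff by blast
    then have "vec 2 (\<lambda>i. J f l (y $ i) (c $ i)) $ 0 \<le> vec 2 (\<lambda>i. J f l (y $ i) (c $ i)) $ 1"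
      unfolding ramp_def by (meson one_less_numeral_iff semiring_norm(76) zero_le)
    then show ?thesis by (simp add: y_def c_def)
  qed
  then show ?thesis
    unfolding nondecreasing_separately_def by (auto simp: mono_on_def)
qed

section \<open>Reversal of the indices\<close>

definition reverse_mat :: "nat \<Rightarrow> real mat \<Rightarrow> real mat" where
  "reverse_mat n A = mat n n (\<lambda>(i, j). A $$ (n - 1 - i, n - 1 - j))"

lemma reverse_mat_carrier: "reverse_mat n A \<in> carrier_mat n n"
  by (simp add: reverse_mat_def)

lemma reverse_reverse_mat: "A \<in> carrier_mat n n \<Longrightarrow> reverse_mat n (reverse_mat n A) = A"
  by (intro eq_matI) (auto simp: reverse_mat_def)

lemma sum_lessThan_reverse: "(\<Sum>i<n. g (n - 1 - i)) = (\<Sum>i<n. g i)"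
  for g :: "nat \<Rightarrow> real"
  using sum.nat_diff_reindex[of g n] by simp

text \<open>
  Reversal is congruence by a permutation matrix: the form of the reversed matrix at \<open>v\<close> is the
  form of \<open>A\<close> at the reversed vector.
\<close>
lemma psd_reverse_mat:
  assumes "psd n A"
  shows "psd n (reverse_mat n A)"
proof -
  have A: "A \<in> carrier_mat n n" and sym: "A\<^sup>T = A"
    using assms by (auto simp: psd_def)
  have entry: "A $$ (i, j) = A $$ (j, i)" if "i < n" "j < n" for i j
    using arg_cong[OF sym, of "\<lambda>M. M $$ (j, i)"] A that by auto
  have "0 \<le> v \<bullet> (reverse_mat n A *\<^sub>v v)" if v: "v \<in> carrier_vec n" for v
  proof -
    define w where "w = vec n (\<lambda>i. v $ (n - 1 - i))"
    have "v \<bullet> (reverse_mat n A *\<^sub>v v)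
        = (\<Sum>i<n. \<Sum>j<n. v $ i * v $ j * A $$ (n - 1 - i, n - 1 - j))"
      by (subst quadratic_form_eq_sum[OF reverse_mat_carrier v])
        (auto simp: reverse_mat_def intro!: sum.cong)
    also have "\<dots> = (\<Sum>i<n. \<Sum>j<n. w $ (n - 1 - i) * w $ (n - 1 - j) * A $$ (n - 1 - i, n - 1 - j))"
      by (auto simp: w_def intro!: sum.cong)
    also have "\<dots> = (\<Sum>i<n. \<Sum>j<n. w $ (n - 1 - i) * w $ j * A $$ (n - 1 - i, j))"
      by (intro sum.cong refl sum_lessThan_reverse[where g = "\<lambda>j. w $ (n - 1 - i) * w $ j * A $$ (n - 1 - i, j)" for i])
    also have "\<dots> = (\<Sum>i<n. \<Sum>j<n. w $ i * w $ j * A $$ (i, j))"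
      by (rule sum_lessThan_reverse[where g = "\<lambda>i. \<Sum>j<n. w $ i * w $ j * A $$ (i, j)"])
    also have "\<dots> = w \<bullet> (A *\<^sub>v w)"
      by (rule quadratic_form_eq_sum[OF A, symmetric]) (simp add: w_def)
    also have "\<dots> \<ge> 0"
      using assms by (simp add: psd_def w_def)
    finally show ?thesis .
  qed
  moreover have "(reverse_mat n A)\<^sup>T = reverse_mat n A"
    by (intro eq_matI) (auto simp: reverse_mat_def intro!: entry)
  ultimately show ?thesis
    unfolding psd_def using reverse_mat_carrier by simp
qed

lemma loewner_le_reverse_mat_iff:
  assumes "A \<in> carrier_mat n n" "B \<in> carrier_mat n n"
  shows "loewner_le n (reverse_mat n A) (reverse_mat n B) \<longleftrightarrow> loewner_le n A B"
proof -
  have "reverse_mat n B - reverse_mat n A = reverse_mat n (B - A)"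
    using assms by (intro eq_matI) (auto simp: reverse_mat_def)
  moreover have "psd n (reverse_mat n (B - A)) \<longleftrightarrow> psd n (B - A)"
    using psd_reverse_mat reverse_reverse_mat[of "B - A" n] assms
    by (metis minus_carrier_mat)
  ultimately show ?thesis by (simp add: loewner_le_def)
qed

lemma C_min_carrier: "A \<in> C_min n \<Longrightarrow> A \<in> carrier_mat n n"
  using A_min_carrier by (auto simp: C_min_def)

lemma C_max_eq_reverse_C_min: "C_max n = reverse_mat n ` C_min n"
proof -
  define r where "r x = vec n (\<lambda>i. x $ (n - 1 - i))" for x :: "real vec"
  have r: "r x \<in> carrier_vec n" for x by (simp add: r_def)
  have ramp_r: "ramp n (r x) \<longleftrightarrow>
    (\<forall>i<n. 0 \<le> x $ i) \<and> (\<forall>i j. i \<le> j \<and> j < n \<longrightarrow> x $ j \<le> x $ i)"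
    (is "_ \<longleftrightarrow> ?decr") for x
  proof
    assume h: "ramp n (r x)"
    have "0 \<le> x $ i" if "i < n" for i
      using h[unfolded ramp_def, THEN conjunct1, rule_format, of "n - 1 - i"] that
      by (simp add: r_def)
    moreover have "x $ j \<le> x $ i" if "i \<le> j" "j < n" for i j
      using h[unfolded ramp_def, THEN conjunct2, rule_format, of "n - 1 - j" "n - 1 - i"] that
      by (simp add: r_def)
    ultimately show ?decr by blast
  qed (auto simp: ramp_def r_def)
  have rev: "reverse_mat n (A_min (r x)) = A_max x" if "x \<in> carrier_vec n" for x
  proof -
    have "n - 1 - min (n - 1 - i) (n - 1 - j) = max i j" if "i < n" "j < n" for i j
      using that by linarith
    then show ?thesis
      using that by (intro eq_matI) (auto simp: reverse_mat_def A_min_def A_max_def r_def)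
  qed
  have rr: "r (r x) = x" if "x \<in> carrier_vec n" for x
    using that by (intro eq_vecI) (auto simp: r_def)
  have max: "C_max n = {A_max x | x. x \<in> carrier_vec n \<and> ramp n (r x)}"
    unfolding C_max_def ramp_r ..
  show ?thesis
  proof (intro equalityI subsetI)
    fix A assume "A \<in> C_max n"
    then obtain x where x: "A = A_max x" "x \<in> carrier_vec n" "ramp n (r x)"
      unfolding max by auto
    then have "A = reverse_mat n (A_min (r x))" "A_min (r x) \<in> C_min n"
      using rev r unfolding C_min_eq_ramp by auto
    then show "A \<in> reverse_mat n ` C_min n" by blast
  next
    fix A assume "A \<in> reverse_mat n ` C_min n"
    then obtain x where x: "A = reverse_mat n (A_min x)" "x \<in> carrier_vec n" "ramp n x"
      unfolding C_min_eq_ramp by auto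
    then have "A = A_max (r x)" "ramp n (r (r x))"
      using rev[OF r, of x] rr by auto
    then show "A \<in> C_max n" unfolding max using r by blast
  qed
qed

text \<open>
  Reversal maps one cone onto the other, commutes with entrywise maps and linear combinations, and
  preserves the Loewner order in both directions, so it carries the whole definition over.
\<close>
lemma convex_on_C_max_iff_C_min:
  "loewner_convex_on n (C_max n) f \<longleftrightarrow> loewner_convex_on n (C_min n) f"
proof -
  have left: "map_mat f (l \<cdot>\<^sub>m reverse_mat n A + (1 - l) \<cdot>\<^sub>m reverse_mat n B)
      = reverse_mat n (map_mat f (l \<cdot>\<^sub>m A + (1 - l) \<cdot>\<^sub>m B))"
    and right: "l \<cdot>\<^sub>m map_mat f (reverse_mat n A) + (1 - l) \<cdot>\<^sub>m map_mat f (reverse_mat n B)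
      = reverse_mat n (l \<cdot>\<^sub>m map_mat f A + (1 - l) \<cdot>\<^sub>m map_mat f B)"
    if "A \<in> C_min n" "B \<in> C_min n" for A B l
    using that[THEN C_min_carrier] by (auto simp: reverse_mat_def intro!: eq_matI)
  show ?thesis
    unfolding loewner_convex_on_def C_max_eq_reverse_C_min ball_simps
    by (intro ball_cong refl arg_cong[where f = All] ext)
      (simp add: left right loewner_le_reverse_mat_iff C_min_carrier)
qed

section \<open>Concavity and the characterization\<close>

lemma concave_on_iff_convex_on_uminus:
  assumes "C \<subseteq> carrier_mat n n"
  shows "loewner_concave_on n C f \<longleftrightarrow> loewner_convex_on n C (\<lambda>t. - f t)"
proof -
  have "map_mat f (l \<cdot>\<^sub>m A + (1 - l) \<cdot>\<^sub>m B) - (l \<cdot>\<^sub>m map_mat f A + (1 - l) \<cdot>\<^sub>m map_mat f B)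
    = (l \<cdot>\<^sub>m map_mat (\<lambda>t. - f t) A + (1 - l) \<cdot>\<^sub>m map_mat (\<lambda>t. - f t) B)
      - map_mat (\<lambda>t. - f t) (l \<cdot>\<^sub>m A + (1 - l) \<cdot>\<^sub>m B)"
    if "A \<in> C" "B \<in> C" for A B l
  proof -
    have "A \<in> carrier_mat n n" "B \<in> carrier_mat n n"
      using assms that by auto
    then show ?thesis by (intro eq_matI) auto
  qed
  then show ?thesis
    unfolding loewner_concave_on_def loewner_convex_on_def
    by (intro ball_cong refl arg_cong[where f = All] ext)
      (simp add: loewner_le_def)
qed

lemma nonincreasing_J_iff_nondecreasing_J_uminus:
  "nonincreasing_separately (J f l) \<longleftrightarrow> nondecreasing_separately (J (\<lambda>t. - f t) l)"
proof -
  have "J (\<lambda>t. - f t) l = (\<lambda>s d. - J f l s d)"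
    by (intro ext) (simp add: J_def)
  then show ?thesis
    unfolding nonincreasing_separately_def nondecreasing_separately_def
    by (simp add: monotone_on_def)
qed

theorem proposition5p6:
  fixes f :: "real \<Rightarrow> real"
  shows "((\<forall>n\<ge>1. loewner_convex_on n (C_min n) f) \<longleftrightarrow>
            (\<forall>l. 0 \<le> l \<and> l \<le> 1 \<longrightarrow> nondecreasing_separately (J f l)))
       \<and> ((\<forall>n\<ge>1. loewner_concave_on n (C_min n) f) \<longleftrightarrow>
            (\<forall>l. 0 \<le> l \<and> l \<le> 1 \<longrightarrow> nonincreasing_separately (J f l)))
       \<and> ((\<forall>n\<ge>1. loewner_convex_on n (C_max n) f) \<longleftrightarrow>
            (\<forall>l. 0 \<le> l \<and> l \<le> 1 \<longrightarrow> nondecreasing_separately (J f l)))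
       \<and> ((\<forall>n\<ge>1. loewner_concave_on n (C_max n) f) \<longleftrightarrow>
            (\<forall>l. 0 \<le> l \<and> l \<le> 1 \<longrightarrow> nonincreasing_separately (J f l)))
       \<and> (loewner_convex_on 2 (C_min 2) f \<longrightarrow>
            (\<forall>l. 0 \<le> l \<and> l \<le> 1 \<longrightarrow> nondecreasing_separately (J f l)))
       \<and> (loewner_concave_on 2 (C_min 2) f \<longrightarrow>
            (\<forall>l. 0 \<le> l \<and> l \<le> 1 \<longrightarrow> nonincreasing_separately (J f l)))
       \<and> (loewner_convex_on 2 (C_max 2) f \<longrightarrow>
            (\<forall>l. 0 \<le> l \<and> l \<le> 1 \<longrightarrow> nondecreasing_separately (J f l)))
       \<and> (loewner_concave_on 2 (C_max 2) f \<longrightarrow>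
            (\<forall>l. 0 \<le> l \<and> l \<le> 1 \<longrightarrow> nonincreasing_separately (J f l)))"
proof -
  have concave_min: "loewner_concave_on n (C_min n) f \<longleftrightarrow> loewner_convex_on n (C_min n) (\<lambda>t. - f t)" for n
    using C_min_carrier by (intro concave_on_iff_convex_on_uminus) auto
  have concave_max: "loewner_concave_on n (C_max n) f \<longleftrightarrow> loewner_convex_on n (C_min n) (\<lambda>t. - f t)" for n
    using concave_on_iff_convex_on_uminus[of "C_max n" n f] convex_on_C_max_iff_C_min
      reverse_mat_carrier by (auto simp: C_max_eq_reverse_C_min)
  have dim2: "loewner_convex_on 2 (C_min 2) g \<longrightarrow>
      (\<forall>l. 0 \<le> l \<and> l \<le> 1 \<longrightarrow> nondecreasing_separately (J g l))" for g
    using nondecreasing_if_convex_on_C_min_2 by blast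
  \<comment> \<open>The case \<open>n = 2\<close> of the left-hand side already gives the right-hand side.\<close>
  have all_dims: "(\<forall>n\<ge>1. loewner_convex_on n (C_min n) g) \<longleftrightarrow>
      (\<forall>l. 0 \<le> l \<and> l \<le> 1 \<longrightarrow> nondecreasing_separately (J g l))" for g
    using dim2[of g] convex_on_C_min_if_nondecreasing[of g] by (meson one_le_numeral)
  show ?thesis
    unfolding concave_min concave_max convex_on_C_max_iff_C_min
      nonincreasing_J_iff_nondecreasing_J_uminus
    using dim2 all_dims by blast
qed

end
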